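(* Let $s,\sigma>0$ and let $0\ne f\in\mathcal S_s^\sigma(\mathbb R)$. If $s<1$ or $\sigma<1$, then every finite collection of distinct Weyl shifts of $f$ is linearly independent; that is, for every finite set $\Lambda\subset\mathbb R^2$ of distinct points, the family $\{\rho(z)f\}_{z\in\Lambda}$ is linearly independent over $\mathbb C$.
   Context: For $z=(x,\omega)\in\mathbb R^2$, the Weyl shift on $L^2(\mathbb R)$ is $(\rho(x,\omega)f)(t)=e^{2\pi i\omega(t-x/2)}f(t-x)$. For $s,\sigma>0$, the Roumieu Gelfand--Shilov class $\mathcal S_s^\sigma(\mathbb R)$ consists of the functions $f\in C^\infty(\mathbb R)$ (complex-valued) for which there are constants $C,h>0$ with $\sup_{t\in\mathbb R}|t^m f^{(n)}(t)|\le C h^{m+n}(m!)^s(n!)^\sigma$ for all integers $m,n\ge0$. *)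

theory Defs
  imports "HOL-Analysis.Analysis"
begin

definition weyl_shift :: "real \<times> real \<Rightarrow> (real \<Rightarrow> complex) \<Rightarrow> (real \<Rightarrow> complex)" where
  "weyl_shift z f = (\<lambda>t. exp (2 * complex_of_real pi * \<i> * complex_of_real (snd z * (t - fst z / 2)))
                         * f (t - fst z))"

definition nth_deriv :: "nat \<Rightarrow> (real \<Rightarrow> complex) \<Rightarrow> (real \<Rightarrow> complex)" where
  "nth_deriv n f = ((\<lambda>g t. vector_derivative g (at t)) ^^ n) f"

definition smooth :: "(real \<Rightarrow> complex) \<Rightarrow> bool" where
  "smooth f \<longleftrightarrow> (\<forall>n t. nth_deriv n f differentiable (at t))"

definition gelfand_shilov :: "real \<Rightarrow> real \<Rightarrow> (real \<Rightarrow> complex) set" where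
  "gelfand_shilov s \<sigma> = {f. smooth f \<and>
     (\<exists>C>0. \<exists>h>0. \<forall>m n t. norm (of_real (t ^ m) * nth_deriv n f t)
        \<le> C * h ^ (m + n) * fact m powr s * fact n powr \<sigma>)}"

(* Elements of L^2 are represented by functions up to equality almost everywhere, so a linear
   relation in L^2 is an identity holding almost everywhere. Independence is that of the family
   indexed by I: in particular, distinct indices with F i = F j almost everywhere make it fail. *)
definition lin_indep_family_AE :: "'i set \<Rightarrow> ('i \<Rightarrow> real \<Rightarrow> complex) \<Rightarrow> bool" where
  "lin_indep_family_AE I F \<longleftrightarrow>
     (\<forall>J c. finite J \<longrightarrow> J \<subseteq> I \<longrightarrow> (AE t in lborel. (\<Sum>i\<in>J. c i * F i t) = 0)
        \<longrightarrow> (\<forall>i\<in>J. c i = (0::complex)))"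

end

theory Submission
  imports Defs "HOL-Probability.Levy" "HOL-Probability.Sinc_Integral"
begin

text \<open>
  The two alternatives \<open>s < 1\<close> and \<open>\<sigma> < 1\<close> are exchanged by the Fourier transform, which turns a
  time shift into a frequency shift and smoothness of order \<open>\<sigma>\<close> into decay of order \<open>\<sigma>\<close>. Both
  therefore follow from one statement about a continuous function that decays superexponentially,
  in the sense that \<open>\<bar>t\<bar>\<^sup>m \<bar>f t\<bar> \<le> C h\<^sup>m (m!)\<^sup>s\<close> for all \<open>m\<close> and some \<open>s < 1\<close>: no nontrivial
  linear relation between Weyl shifts of such an \<open>f\<close> holds unless \<open>f = 0\<close>
  (\<open>superexponential_decay_imp_no_weyl_relation\<close>).

  The argument is that of Bownik and Speegle. Collect the terms of the relation according to the
  time shift. After a translation the relation reads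
  \<open>P(t) f(t) = - (\<Sum>x\<in>D. P\<^sub>x(t) f(t + x))\<close>
  with trigonometric polynomials \<open>P \<noteq> 0\<close> and \<open>P\<^sub>x\<close> and a finite set \<open>D\<close> of positive numbers. Dividing by
  \<open>P\<close> and iterating \<open>n\<close> times expresses \<open>f(t)\<close> through values of \<open>f\<close> at points beyond \<open>t + n d\<close>,
  \<open>d = min D\<close>, where \<open>f\<close> is tiny. The price is a product of reciprocals of \<open>n\<close> values of \<open>P\<close>
  at points \<open>t + y\<close>, where \<open>y\<close> is a sum of at most \<open>n\<close> elements of \<open>D\<close>.

  There are only polynomially many such sums of a given length, and \<open>\<bar>P\<bar> < \<epsilon>\<close> holds, on intervals of a
  fixed length and uniformly in their position, only on a set of measure \<open>O(\<epsilon>\<^sup>\<kappa>)\<close> for some \<open>\<kappa> > 0\<close>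
  (\<open>exp_poly_sublevel_measure\<close>). A Borel--Cantelli argument gives, in every interval, a point \<open>t\<close> with
  \<open>\<bar>P(t + y)\<bar> \<ge> a / (n + 1)\<^sup>R\<close> for all sums \<open>y\<close> of \<open>n\<close> elements
  (\<open>exp_poly_lower_bound_along_step_sums\<close>). So the iteration costs at most \<open>K\<^sup>n (n!)\<^sup>R\<close>, which the decay
  of \<open>f\<close> beats because \<open>s < 1\<close>. Hence \<open>f\<close> has a zero in every interval, and \<open>f = 0\<close> by continuity.
\<close>

section \<open>Sublevel sets of exponential polynomials\<close>

text \<open>
  The \<open>k\<close>-th derivative of \<open>\<Sum>a\<in>A. c a * cis (w a * t)\<close>; the exponential polynomial itself is the
  case \<open>k = 0\<close>. Keeping the derivatives as one explicit family makes the sums over \<open>k\<close> below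
  computable termwise.
\<close>

definition exp_poly_deriv :: "'a set \<Rightarrow> ('a \<Rightarrow> complex) \<Rightarrow> ('a \<Rightarrow> real) \<Rightarrow> nat \<Rightarrow> real \<Rightarrow> complex" where
  "exp_poly_deriv A c w k t = (\<Sum>a\<in>A. c a * (\<i> * of_real (w a)) ^ k * cis (w a * t))"

lemma exp_poly_deriv_has_vector_derivative:
  "(exp_poly_deriv A c w k has_vector_derivative exp_poly_deriv A c w (Suc k) t) (at t)"
proof -
  have cis': "((\<lambda>t. cis (w a * t)) has_vector_derivative \<i> * of_real (w a) * cis (w a * t)) (at t)" for a
    by (auto intro!: derivative_eq_intros simp: has_vector_derivative_def scaleR_conv_of_real algebra_simps)
  have "((\<lambda>t. \<Sum>a\<in>A. (c a * (\<i> * of_real (w a)) ^ k) * cis (w a * t)) has_vector_derivative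
         (\<Sum>a\<in>A. (c a * (\<i> * of_real (w a)) ^ k) * (\<i> * of_real (w a) * cis (w a * t)))) (at t)"
    by (intro has_vector_derivative_sum has_vector_derivative_mult_right cis')
  moreover have "(\<Sum>a\<in>A. (c a * (\<i> * of_real (w a)) ^ k) * (\<i> * of_real (w a) * cis (w a * t)))
      = exp_poly_deriv A c w (Suc k) t"
    unfolding exp_poly_deriv_def by (intro sum.cong) (auto simp: algebra_simps)
  ultimately show ?thesis unfolding exp_poly_deriv_def by simp
qed

lemma exp_poly_deriv_bounded:
  assumes "k \<le> N"
  shows "norm (exp_poly_deriv A c w k t) \<le> (\<Sum>a\<in>A. norm (c a) * (1 + \<bar>w a\<bar>) ^ N)"
  unfolding exp_poly_deriv_def
proof (rule sum_norm_le)
  fix a assume "a \<in> A"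
  have "\<bar>w a\<bar> ^ k \<le> (1 + \<bar>w a\<bar>) ^ k" by (rule power_mono) auto
  also have "\<dots> \<le> (1 + \<bar>w a\<bar>) ^ N" by (rule power_increasing[OF assms]) simp
  finally show "norm (c a * (\<i> * complex_of_real (w a)) ^ k * cis (w a * t)) \<le> norm (c a) * (1 + \<bar>w a\<bar>) ^ N"
    by (simp add: norm_mult norm_power mult_left_mono)
qed

text \<open>
  The differential operator \<open>\<Prod>a\<in>A - {b}. (d/dt - \<i> w a)\<close> annihilates every term except the one with
  frequency \<open>w b\<close>, which it multiplies by a nonzero constant. Its value is thus of constant modulus, and
  it is a fixed linear combination of fewer than \<open>card A\<close> successive derivatives.
\<close>

lemma exp_poly_derivs_not_all_small:
  assumes "finite A" "inj_on w A" "b \<in> A" "c b \<noteq> 0"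
  obtains \<delta> where "\<delta> > 0" "\<And>t. \<exists>k<card A. \<delta> \<le> norm (exp_poly_deriv A c w k t)"
proof -
  \<comment> \<open>The symbol of the annihilating operator: \<open>d/dt\<close> acts on the term \<open>a\<close> as multiplication by \<open>\<i> w a\<close>.\<close>
  define q :: "complex poly" where "q = (\<Prod>a\<in>A - {b}. [:- (\<i> * of_real (w a)), 1:])"
  have deg: "degree q < card A"
  proof -
    have "degree q = (\<Sum>a\<in>A - {b}. degree [:- (\<i> * of_real (w a)), 1::complex:])"
      unfolding q_def by (intro degree_prod_sum_eq) auto
    also have "\<dots> = card (A - {b})" by simp
    also have "\<dots> < card A" using assms by (intro card_Diff1_less) auto
    finally show ?thesis .
  qed
  define \<kappa> where "\<kappa> = norm (c b * poly q (\<i> * of_real (w b)))"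
  have q0: "poly q (\<i> * of_real (w a)) = 0" if "a \<in> A" "a \<noteq> b" for a
    unfolding q_def poly_prod using that assms by (auto simp: prod_zero_iff)
  have "poly q (\<i> * of_real (w b)) \<noteq> 0"
    unfolding q_def poly_prod using assms by (auto simp: prod_zero_iff inj_on_def)
  hence \<kappa>: "\<kappa> > 0" using assms by (simp add: \<kappa>_def)
  have key: "norm (\<Sum>k\<le>degree q. coeff q k * exp_poly_deriv A c w k t) = \<kappa>" for t
  proof -
    have "(\<Sum>k\<le>degree q. coeff q k * exp_poly_deriv A c w k t)
        = (\<Sum>a\<in>A. \<Sum>k\<le>degree q. coeff q k * (c a * (\<i> * of_real (w a)) ^ k * cis (w a * t)))"
      unfolding exp_poly_deriv_def sum_distrib_left by (rule sum.swap)
    also have "\<dots> = (\<Sum>a\<in>A. c a * poly q (\<i> * of_real (w a)) * cis (w a * t))"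
      by (intro sum.cong refl) (simp add: poly_altdef sum_distrib_left sum_distrib_right algebra_simps)
    also have "\<dots> = (\<Sum>a\<in>{b}. c a * poly q (\<i> * of_real (w a)) * cis (w a * t))"
      using assms q0 by (intro sum.mono_neutral_right) auto
    finally show ?thesis by (simp add: \<kappa>_def norm_mult)
  qed
  define S where "S = 1 + (\<Sum>k\<le>degree q. norm (coeff q k))"
  have S: "S > 0" unfolding S_def by (intro add_pos_nonneg sum_nonneg) auto
  show ?thesis
  proof (rule that[of "\<kappa> / S"])
    show "\<kappa> / S > 0" using \<kappa> S by simp
    fix t
    show "\<exists>k<card A. \<kappa> / S \<le> norm (exp_poly_deriv A c w k t)"
    proof (rule ccontr)
      assume "\<not> ?thesis"
      hence small: "norm (exp_poly_deriv A c w k t) \<le> \<kappa> / S" if "k \<le> degree q" for k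
        using that deg by (meson le_less_trans linorder_not_le order_less_imp_le)
      have "\<kappa> = norm (\<Sum>k\<le>degree q. coeff q k * exp_poly_deriv A c w k t)" by (rule key[symmetric])
      also have "\<dots> \<le> (\<Sum>k\<le>degree q. norm (coeff q k) * (\<kappa> / S))"
        by (rule sum_norm_le) (auto simp: norm_mult simp del: times_divide_eq_right intro!: mult_left_mono small)
      also have "\<dots> = (S - 1) * (\<kappa> / S)"
        by (simp add: S_def flip: sum_distrib_right sum_divide_distrib)
      also have "\<dots> < \<kappa>" using S \<kappa> by (simp add: field_simps)
      finally show False by simp
    qed
  qed
qed

text \<open>
  Rolle's argument with quantities. Pair the \<open>2 ^ k\<close> points off: the mean value theorem gives, between the
  two points of each pair, a point where the first derivative is at most \<open>2 \<epsilon> / h\<close>. As pairs do not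
  overlap, these \<open>2 ^ (k - 1)\<close> points are again separated by \<open>h\<close>, and the step can be repeated.
\<close>

lemma separated_small_values_imp_small_derivative:
  fixes G :: "nat \<Rightarrow> real \<Rightarrow> real"
  assumes "\<And>k t. (G k has_real_derivative G (Suc k) t) (at t)" "h > 0"
    and "\<And>i. i < 2 ^ k \<Longrightarrow> p i \<in> {a..b} \<and> \<bar>G 0 (p i)\<bar> \<le> \<epsilon>"
    and "\<And>i. Suc i < 2 ^ k \<Longrightarrow> p i + h \<le> p (Suc i)"
  shows "\<exists>t\<in>{a..b}. \<bar>G k t\<bar> \<le> (2 / h) ^ k * \<epsilon>"
  using assms
proof (induction k arbitrary: G p \<epsilon>)
  case 0
  then show ?case by force
next
  case (Suc k)
  have "\<exists>t. p (2*i) < t \<and> t < p (Suc (2*i)) \<and> \<bar>G 1 t\<bar> \<le> 2 / h * \<epsilon>" if i: "i < 2 ^ k" for i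
  proof -
    have sep: "p (2*i) + h \<le> p (Suc (2*i))" using Suc.prems(4) i by simp
    hence lt: "p (2*i) < p (Suc (2*i))" using \<open>h > 0\<close> by simp
    obtain z where z: "p (2*i) < z" "z < p (Suc (2*i))"
      "G 0 (p (Suc (2*i))) - G 0 (p (2*i)) = (p (Suc (2*i)) - p (2*i)) * G 1 z"
      using MVT2[OF lt, of "G 0" "G 1"] Suc.prems(1)[of 0] by auto
    have "h * \<bar>G 1 z\<bar> \<le> (p (Suc (2*i)) - p (2*i)) * \<bar>G 1 z\<bar>"
      using sep by (intro mult_right_mono) auto
    also have "\<dots> = \<bar>G 0 (p (Suc (2*i))) - G 0 (p (2*i))\<bar>" using z lt by (simp add: abs_mult)
    also have "\<dots> \<le> \<epsilon> + \<epsilon>"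
      using Suc.prems(3)[of "2*i"] Suc.prems(3)[of "Suc (2*i)"] i by (simp add: abs_le_iff)
    finally have "\<bar>G 1 z\<bar> \<le> 2 / h * \<epsilon>" using \<open>h > 0\<close> by (simp add: field_simps)
    thus ?thesis using z by blast
  qed
  then obtain r where r: "\<And>i. i < 2 ^ k \<Longrightarrow> p (2*i) < r i \<and> r i < p (Suc (2*i)) \<and> \<bar>G 1 (r i)\<bar> \<le> 2 / h * \<epsilon>"
    by metis
  have "\<exists>t\<in>{a..b}. \<bar>G (Suc k) t\<bar> \<le> (2 / h) ^ k * (2 / h * \<epsilon>)"
  proof (rule Suc.IH[of "\<lambda>k. G (Suc k)" r])
    show "(G (Suc j) has_real_derivative G (Suc (Suc j)) t) (at t)" for j t by (rule Suc.prems)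
    show "r i \<in> {a..b} \<and> \<bar>G (Suc 0) (r i)\<bar> \<le> 2 / h * \<epsilon>" if "i < 2 ^ k" for i
      using r[OF that] Suc.prems(3)[of "2*i"] Suc.prems(3)[of "Suc (2*i)"] that by simp
    show "r i + h \<le> r (Suc i)" if "Suc i < 2 ^ k" for i
      using r[of i] r[of "Suc i"] Suc.prems(4)[of "Suc (2*i)"] that by simp
  qed fact
  then show ?case by (simp add: algebra_simps)
qed

text \<open>
  Greedy choice: take a point of \<open>E\<close> within \<open>h\<close> of the infimum and discard everything up to distance \<open>h\<close>
  beyond it, which costs measure at most \<open>2 h\<close>.
\<close>

lemma large_measure_imp_separated_points:
  fixes E :: "real set"
  assumes "E \<in> sets borel" "bdd_below E" "h > 0" "emeasure lborel E > ennreal (2 * h * real n)"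
  shows "\<exists>p. (\<forall>i\<le>n. p i \<in> E) \<and> (\<forall>i<n. p i + h \<le> p (Suc i))"
  using assms
proof (induction n arbitrary: E)
  case 0
  then show ?case by (cases "E = {}") auto
next
  case (Suc n)
  have "E \<noteq> {}" using Suc.prems(4) by auto
  then obtain x where x: "x \<in> E" "x < Inf E + h"
    using cInf_lessD[of E "Inf E + h"] Suc.prems by auto
  let ?E = "E \<inter> {x + h..}"
  have "E \<subseteq> {Inf E..Inf E + 2 * h} \<union> ?E"
    using x cInf_lower[OF _ Suc.prems(2)] by force
  hence "emeasure lborel E \<le> emeasure lborel ({Inf E..Inf E + 2 * h} \<union> ?E)"
    using Suc.prems by (intro emeasure_mono) auto
  also have "\<dots> \<le> emeasure lborel {Inf E..Inf E + 2 * h} + emeasure lborel ?E"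
    using Suc.prems by (intro emeasure_subadditive) auto
  also have "\<dots> = ennreal (2 * h) + emeasure lborel ?E" using Suc.prems by simp
  finally have le: "emeasure lborel E \<le> ennreal (2 * h) + emeasure lborel ?E" .
  have "emeasure lborel ?E > ennreal (2 * h * real n)"
  proof (rule ccontr)
    assume "\<not> ?thesis"
    hence "emeasure lborel E \<le> ennreal (2 * h) + ennreal (2 * h * real n)"
      using le by (meson add_left_mono linorder_not_le order_trans)
    also have "\<dots> = ennreal (2 * h * real (Suc n))"
      using Suc.prems by (simp flip: ennreal_plus add: algebra_simps)
    finally show False using Suc.prems(4) by simp
  qed
  then obtain p where p: "\<forall>i\<le>n. p i \<in> ?E" "\<forall>i<n. p i + h \<le> p (Suc i)"
    using Suc.IH[of ?E] Suc.prems by (auto intro: bdd_below_mono)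
  show ?case
  proof (intro exI[of _ "case_nat x p"] conjI allI impI)
    show "case_nat x p i \<in> E" if "i \<le> Suc n" for i
      using that p x by (cases i) auto
    show "case_nat x p i + h \<le> case_nat x p (Suc i)" if "i < Suc n" for i
      using that p by (cases i) auto
  qed
qed

text \<open>
  On a short interval some derivative of order \<open>k < card A\<close> stays away from zero in a fixed direction of
  the complex plane. If the sublevel set were large it would contain \<open>2 ^ k\<close> separated points, and
  the projection of the exponential polynomial to that direction would have a small \<open>k\<close>-th derivative
  somewhere. It is essential that \<open>\<eta>\<close> and \<open>\<delta>\<close> do not depend on the position \<open>x\<close> of the interval.
\<close>

lemma exp_poly_sublevel_measure:
  assumes "finite A" "inj_on w A" "b \<in> A" "c b \<noteq> 0"
  obtains \<eta> \<delta> where "\<eta> > 0" "\<delta> > 0"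
    "\<And>x h. 0 < h \<Longrightarrow> h \<le> 2 \<Longrightarrow>
       emeasure lborel {t \<in> {x..x + \<eta>}. norm (exp_poly_deriv A c w 0 t) \<le> \<delta> * (h / 2) ^ card A}
         \<le> ennreal (2 * h * 2 ^ card A)"
proof -
  let ?N = "card A" and ?P = "exp_poly_deriv A c w"
  obtain \<delta> where \<delta>: "\<delta> > 0" "\<And>t. \<exists>k<?N. \<delta> \<le> norm (?P k t)"
    using exp_poly_derivs_not_all_small[where c = c, OF assms] by blast
  define M where "M = 1 + (\<Sum>a\<in>A. norm (c a) * (1 + \<bar>w a\<bar>) ^ ?N)"
  have M: "M > 0" unfolding M_def by (intro add_pos_nonneg sum_nonneg) auto
  have PM: "norm (?P k t) \<le> M" if "k \<le> ?N" for k t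
    using exp_poly_deriv_bounded[OF that, of A c w t] by (simp add: M_def)
  have cont: "continuous_on UNIV (?P 0)"
    using exp_poly_deriv_has_vector_derivative
    by (meson continuous_at_imp_continuous_on has_vector_derivative_continuous)
  show ?thesis
  proof (rule that[of "\<delta> / (2 * M)" "\<delta> / 4"])
    show "0 < \<delta> / (2 * M)" "0 < \<delta> / 4" using \<delta> M by auto
    fix x h :: real assume h: "0 < h" "h \<le> 2"
    let ?y = "x + \<delta> / (2 * M)" and ?\<epsilon> = "\<delta> / 4 * (h / 2) ^ ?N"
    let ?E = "{t \<in> {x..?y}. norm (?P 0 t) \<le> ?\<epsilon>}"
    show "emeasure lborel ?E \<le> ennreal (2 * h * 2 ^ ?N)"
    proof (rule ccontr)
      assume "\<not> ?thesis"
      hence big: "emeasure lborel ?E > ennreal (2 * h * real (2 ^ ?N))" by simp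
      have "closed ({x..?y} \<inter> {t. norm (?P 0 t) \<le> ?\<epsilon>})"
        using cont by (intro closed_Int closed_Collect_le continuous_intros) auto
      hence E: "?E \<in> sets borel" by (simp add: Int_def borel_closed)
      have "bdd_below ?E" by (rule bdd_belowI[of _ x]) simp
      then obtain p where p: "\<forall>i\<le>2 ^ ?N. p i \<in> ?E" "\<forall>i<2 ^ ?N. p i + h \<le> p (Suc i)"
        using large_measure_imp_separated_points[OF E _ h(1) big] by blast
      obtain k where k: "k < ?N" "\<delta> \<le> norm (?P k x)" using \<delta>(2)[of x] by blast
      \<comment> \<open>The mean value theorem needs real functions, so \<open>P\<close> is projected to the direction of its
        \<open>k\<close>-th derivative at \<open>x\<close>.\<close>
      define u where "u = cnj (?P k x) / norm (?P k x)"
      have nu: "norm u = 1" using k \<delta> by (auto simp: u_def norm_divide)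
      define G where "G j t = Re (u * ?P j t)" for j t
      have G: "(G j has_real_derivative G (Suc j) t) (at t)" for j t
        unfolding G_def has_real_derivative_iff_has_vector_derivative
        by (rule bounded_linear.has_vector_derivative[OF bounded_linear_Re])
           (intro has_vector_derivative_mult_right exp_poly_deriv_has_vector_derivative)
      have Gle: "\<bar>G j t\<bar> \<le> norm (?P j t)" for j t
        unfolding G_def using abs_Re_le_cmod[of "u * ?P j t"] nu by (simp add: norm_mult)
      have "\<exists>t\<in>{x..?y}. \<bar>G k t\<bar> \<le> (2 / h) ^ k * ?\<epsilon>"
      proof (rule separated_small_values_imp_small_derivative[where G = G, OF G h(1)])
        fix i :: nat
        have le: "(2::nat) ^ k \<le> 2 ^ ?N" using k by (intro power_increasing) auto
        {
          assume "i < 2 ^ k"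
          hence "i \<le> 2 ^ ?N" using le by linarith
          hence "p i \<in> ?E" using p(1) by blast
          thus "p i \<in> {x..?y} \<and> \<bar>G 0 (p i)\<bar> \<le> ?\<epsilon>"
            using Gle[of 0 "p i"] by simp
        next
          assume "Suc i < 2 ^ k"
          hence "i < 2 ^ ?N" using le by linarith
          thus "p i + h \<le> p (Suc i)" using p(2) by blast
        }
      qed
      then obtain t where t: "t \<in> {x..?y}" "\<bar>G k t\<bar> \<le> (2 / h) ^ k * ?\<epsilon>" by blast
      have "(2 / h) ^ k * ?\<epsilon> = \<delta> / 4 * ((2 / h) ^ k * (h / 2) ^ ?N)" by simp
      also have "(2 / h) ^ k * (h / 2) ^ ?N = (h / 2) ^ (?N - k)"
        using h k by (simp add: power_diff field_simps)
      also have "\<delta> / 4 * (h / 2) ^ (?N - k) \<le> \<delta> / 4 * 1"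
        using h \<delta> by (intro mult_left_mono power_le_one) auto
      finally have Gt: "\<bar>G k t\<bar> \<le> \<delta> / 4" using t by simp
      have Gx: "G k x = norm (?P k x)"
        unfolding G_def u_def by (simp add: complex_norm_square[symmetric] mult.commute power2_eq_square)
      have "\<bar>G k t - G k x\<bar> \<le> M * \<bar>t - x\<bar>"
      proof -
        have "norm (G k t - G k x) \<le> M * norm (t - x)"
        proof (rule field_differentiable_bound[of "{x..?y}" "G k" "G (Suc k)"])
          show "(G k has_field_derivative G (Suc k) z) (at z within {x..?y})" for z
            using G by (rule has_field_derivative_at_within)
          show "norm (G (Suc k) z) \<le> M" for z
            using Gle[of "Suc k" z] PM[of "Suc k" z] k by simp
        qed (use t in auto)
        thus ?thesis by simp
      qed
      also have "\<dots> \<le> M * (\<delta> / (2 * M))" using t M by (intro mult_left_mono) auto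
      also have "\<dots> = \<delta> / 2" using M by simp
      finally show False using Gt Gx k \<delta>(1) by linarith
    qed
  qed
qed

section \<open>Exponential polynomials along sums of steps\<close>

text \<open>
  All sums of \<open>n\<close> elements of \<open>D\<close> with repetition. They are indexed by the multiplicities of the elements,
  since it is the number of multiplicity functions, polynomial in \<open>n\<close>, that has to be counted; sequences
  of steps would be exponentially many.
\<close>

definition step_sums :: "real set \<Rightarrow> nat \<Rightarrow> real set" where
  "step_sums D n = (\<lambda>k. \<Sum>x\<in>D. real (k x) * x) ` {k \<in> D \<rightarrow>\<^sub>E {..n}. sum k D = n}"

lemma finite_step_sums:
  assumes "finite D"
  shows "finite (step_sums D n)"
  unfolding step_sums_def using assms
  by (intro finite_imageI finite_subset[OF _ finite_PiE[of D "\<lambda>_. {..n}"]]) auto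

lemma card_step_sums_le:
  assumes "finite D"
  shows "card (step_sums D n) \<le> Suc n ^ card D"
proof -
  have fin: "finite (D \<rightarrow>\<^sub>E {..n})" using assms by (intro finite_PiE) auto
  have "card (step_sums D n) \<le> card {k \<in> D \<rightarrow>\<^sub>E {..n}. sum k D = n}"
    unfolding step_sums_def using fin by (intro card_image_le) auto
  also have "\<dots> \<le> card (D \<rightarrow>\<^sub>E {..n})" using fin by (intro card_mono) auto
  also have "\<dots> = Suc n ^ card D" using assms by (simp add: card_PiE)
  finally show ?thesis .
qed

lemma zero_in_step_sums: "0 \<in> step_sums D 0"
  unfolding step_sums_def
  by (rule image_eqI[of _ _ "\<lambda>x\<in>D. 0"]) auto

lemma step_sums_Suc:
  assumes "finite D" "y \<in> step_sums D n" "x \<in> D"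
  shows "y + x \<in> step_sums D (Suc n)"
proof -
  obtain k where k: "k \<in> D \<rightarrow>\<^sub>E {..n}" "sum k D = n" "y = (\<Sum>x\<in>D. real (k x) * x)"
    using assms(2) unfolding step_sums_def by auto
  show ?thesis unfolding step_sums_def
  proof (rule image_eqI[of _ _ "k(x := Suc (k x))"])
    show "y + x = (\<Sum>z\<in>D. real ((k(x := Suc (k x))) z) * z)"
      using assms k(3) by (simp add: sum.remove[of D x] algebra_simps)
    have "sum (k(x := Suc (k x))) D = Suc n"
      using assms k(2) by (simp add: sum.remove[of D x])
    moreover have "k(x := Suc (k x)) \<in> D \<rightarrow>\<^sub>E {..Suc n}"
      using k(1) assms(3) by (auto simp: PiE_iff extensional_def intro: le_SucI)
    ultimately show "k(x := Suc (k x)) \<in> {k \<in> D \<rightarrow>\<^sub>E {..Suc n}. sum k D = Suc n}" by simp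
  qed
qed

lemma step_sums_ge:
  assumes "y \<in> step_sums D n" "\<And>x. x \<in> D \<Longrightarrow> d \<le> x"
  shows "real n * d \<le> y"
proof -
  obtain k where k: "sum k D = n" "y = (\<Sum>x\<in>D. real (k x) * x)"
    using assms(1) unfolding step_sums_def by auto
  have "real n * d = (\<Sum>x\<in>D. real (k x) * d)"
    unfolding k(1)[symmetric] by (simp add: sum_distrib_right)
  also have "\<dots> \<le> y" unfolding k(2) by (intro sum_mono mult_left_mono assms) auto
  finally show ?thesis .
qed

text \<open>
  Borel--Cantelli: with thresholds decreasing polynomially in \<open>n\<close>, the exceptional sets belonging to all
  \<open>n\<close> and all sums of \<open>n\<close> steps have total measure less than the length of the interval, so that some
  point avoids all of them.
\<close>

lemma exp_poly_lower_bound_along_step_sums: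
  assumes "finite A" "inj_on w A" "b \<in> A" "c b \<noteq> 0"
    and "finite D" "\<alpha> < \<beta>"
  obtains a R t where "a > 0" "t \<in> {\<alpha>..\<beta>}"
    "\<And>n y. y \<in> step_sums D n \<Longrightarrow> a / real (Suc n) ^ R \<le> norm (exp_poly_deriv A c w 0 (t + y))"
proof -
  let ?N = "card A" and ?P = "exp_poly_deriv A c w 0" and ?d = "card D"
  obtain \<eta> \<delta> where \<eta>: "\<eta> > 0" and \<delta>: "\<delta> > 0" and sub:
    "\<And>x h. 0 < h \<Longrightarrow> h \<le> 2 \<Longrightarrow>
       emeasure lborel {t \<in> {x..x + \<eta>}. norm (?P t) \<le> \<delta> * (h / 2) ^ ?N} \<le> ennreal (2 * h * 2 ^ ?N)"
    using exp_poly_sublevel_measure[where c = c, OF assms(1-4)] by blast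
  have cont: "continuous_on UNIV ?P"
    using exp_poly_deriv_has_vector_derivative
    by (meson continuous_at_imp_continuous_on has_vector_derivative_continuous)
  define \<gamma> where "\<gamma> = min \<beta> (\<alpha> + \<eta>)"
  have \<gamma>: "\<alpha> < \<gamma>" "\<gamma> \<le> \<beta>" "\<gamma> \<le> \<alpha> + \<eta>" using \<eta> assms(6) by (auto simp: \<gamma>_def)
  define T where "T = (\<Sum>n. 1 / real (Suc n) ^ 2)"
  have summable: "summable (\<lambda>n. 1 / real (Suc n) ^ 2)"
    using inverse_squares_sums by (simp add: sums_iff add.commute)
  have T: "T \<ge> 0" unfolding T_def by (intro suminf_nonneg summable) auto
  define W where "W = 2 * 2 ^ ?N * (T + 1)"
  have W: "W > 0" using T by (simp add: W_def)
  define m where "m = min 2 ((\<gamma> - \<alpha>) / W)"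
  have m: "0 < m" "m \<le> 2" "W * m \<le> \<gamma> - \<alpha>"
    using \<gamma> W by (auto simp: m_def min_def field_simps)
  \<comment> \<open>Of the exponent, \<open>?d\<close> compensates the number of sums of \<open>n\<close> steps and 2 makes the series over
    \<open>n\<close> converge. The factor \<open>m\<close> makes its sum smaller than the length of the interval.\<close>
  define h where "h n = m / real (Suc n) ^ (?d + 2)" for n
  have h: "0 < h n" "h n \<le> 2" for n
  proof -
    show "0 < h n" using m by (simp add: h_def)
    have "h n \<le> m / 1" unfolding h_def using m by (intro divide_left_mono one_le_power) auto
    thus "h n \<le> 2" using m by simp
  qed
  define bad where "bad n y = {t \<in> {\<alpha>..\<gamma>}. norm (?P (t + y)) \<le> \<delta> * (h n / 2) ^ ?N}" for n y
  have closed_bad: "closed (bad n y)" for n y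
  proof -
    have "closed ({\<alpha>..\<gamma>} \<inter> {t. norm (?P (t + y)) \<le> \<delta> * (h n / 2) ^ ?N})"
      by (intro closed_Int closed_Collect_le continuous_intros continuous_on_compose2[OF cont]) auto
    thus ?thesis by (simp add: bad_def Int_def)
  qed
  have bad_le: "emeasure lborel (bad n y) \<le> ennreal (2 * h n * 2 ^ ?N)" for n y
  proof -
    define S where "S = {t \<in> {\<alpha> + y..\<alpha> + y + \<eta>}. norm (?P t) \<le> \<delta> * (h n / 2) ^ ?N}"
    have "closed ({\<alpha> + y..\<alpha> + y + \<eta>} \<inter> {t. norm (?P t) \<le> \<delta> * (h n / 2) ^ ?N})"
      using cont by (intro closed_Int closed_Collect_le continuous_intros) auto
    hence S: "S \<in> sets borel" by (simp add: S_def Int_def borel_closed)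
    have "emeasure lborel (bad n y) \<le> emeasure lborel ((+) y -` S)"
    proof (rule emeasure_mono)
      show "bad n y \<subseteq> (+) y -` S" using \<gamma> by (auto simp: bad_def S_def add.commute)
      show "(+) y -` S \<in> sets lborel" using measurable_sets[of "(+) y" borel borel, OF _ S] by simp
    qed
    also have "\<dots> = emeasure (distr lborel borel ((+) y)) S"
      using emeasure_distr[of "(+) y" lborel borel S, OF _ S] by simp
    also have "\<dots> = emeasure lborel S" by (simp add: lborel_distr_plus)
    also have "\<dots> \<le> ennreal (2 * h n * 2 ^ ?N)"
      unfolding S_def by (rule sub) (rule h)+
    finally show ?thesis .
  qed
  define V where "V n = (\<Union>y\<in>step_sums D n. bad n y)" for n
  have V: "V n \<in> sets lborel" for n
    unfolding V_def using closed_bad assms(5) by (simp add: borel_closed closed_UN finite_step_sums)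
  have level: "emeasure lborel (V n) \<le> ennreal (2 * 2 ^ ?N * m * (1 / real (Suc n) ^ 2))" for n
  proof -
    have "emeasure lborel (V n) \<le> (\<Sum>y\<in>step_sums D n. emeasure lborel (bad n y))"
      unfolding V_def using assms(5) closed_bad
      by (intro emeasure_subadditive_finite finite_step_sums) (auto intro: borel_closed)
    also have "\<dots> \<le> (\<Sum>y\<in>step_sums D n. ennreal (2 * h n * 2 ^ ?N))"
      by (intro sum_mono bad_le)
    also have "\<dots> = ennreal (real (card (step_sums D n)) * (2 * h n * 2 ^ ?N))"
      using h(1)[of n] by (simp add: ennreal_mult ennreal_of_nat_eq_real_of_nat)
    also have "\<dots> \<le> ennreal (real (Suc n ^ ?d) * (2 * h n * 2 ^ ?N))"
      using h(1)[of n] card_step_sums_le[OF assms(5), of n]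
      by (intro ennreal_leI mult_right_mono of_nat_mono) auto
    also have "real (Suc n ^ ?d) * (2 * h n * 2 ^ ?N) = 2 * 2 ^ ?N * m * (1 / real (Suc n) ^ 2)"
      by (simp add: h_def power_add power2_eq_square del: of_nat_Suc)
    finally show ?thesis .
  qed
  have "emeasure lborel (\<Union>n. V n) \<le> (\<Sum>n. emeasure lborel (V n))"
    using V by (intro emeasure_subadditive_countably) blast
  also have "\<dots> \<le> (\<Sum>n. ennreal (2 * 2 ^ ?N * m * (1 / real (Suc n) ^ 2)))"
    by (intro suminf_le level) auto
  also have "\<dots> = ennreal (2 * 2 ^ ?N * m * T)"
    unfolding T_def using m summable
    by (subst suminf_ennreal2) (auto simp: suminf_mult simp del: of_nat_Suc times_divide_eq_right intro!: summable_mult)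
  also have "\<dots> < ennreal (\<gamma> - \<alpha>)"
  proof (rule ennreal_lessI)
    have "2 * 2 ^ ?N * m * T < W * m" using m by (simp add: W_def algebra_simps)
    thus "2 * 2 ^ ?N * m * T < \<gamma> - \<alpha>" using m by linarith
  qed (use \<gamma> in auto)
  also have "\<dots> = emeasure lborel {\<alpha>..\<gamma>}" using \<gamma> by simp
  finally have "\<not> emeasure lborel {\<alpha>..\<gamma>} \<le> emeasure lborel (\<Union>n. V n)" by simp
  moreover have "(\<Union>n. V n) \<in> sets lborel" using V by blast
  ultimately have "\<not> {\<alpha>..\<gamma>} \<subseteq> (\<Union>n. V n)" using emeasure_mono by blast
  then obtain t where t: "t \<in> {\<alpha>..\<gamma>}" "\<And>n y. y \<in> step_sums D n \<Longrightarrow> t \<notin> bad n y"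
    unfolding V_def by blast
  show ?thesis
  proof (rule that[of "\<delta> * (m / 2) ^ ?N" t "(?d + 2) * ?N"])
    show "0 < \<delta> * (m / 2) ^ ?N" using \<delta> m by simp
    show "t \<in> {\<alpha>..\<beta>}" using t \<gamma> by auto
    fix n y assume "y \<in> step_sums D n"
    hence "\<delta> * (h n / 2) ^ ?N \<le> norm (?P (t + y))" using t unfolding bad_def by force
    moreover have "h n / 2 = (m / 2) / real (Suc n) ^ (?d + 2)" by (simp add: h_def del: of_nat_Suc)
    ultimately show "\<delta> * (m / 2) ^ ?N / real (Suc n) ^ ((?d + 2) * ?N) \<le> norm (?P (t + y))"
      by (simp only: power_divide power_mult times_divide_eq_right)
  qed
qed

section \<open>Weyl relations and superexponential decay\<close>

lemma weyl_shift_eq_cis: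
  "weyl_shift z f t = cis (2 * pi * snd z * (t - fst z / 2)) * f (t - fst z)"
  by (simp add: weyl_shift_def cis_conv_exp algebra_simps)

text \<open>
  The factors \<open>K * (k + 1) ^ R\<close> lost in the steps \<open>k < n\<close> multiply to \<open>K ^ n * fact n ^ R\<close>.
\<close>

lemma iterated_step_bound:
  fixes f :: "real \<Rightarrow> 'a::real_normed_vector"
  assumes "finite D" "K \<ge> 0"
    and step: "\<And>n y B. y \<in> step_sums D n \<Longrightarrow> B \<ge> 0 \<Longrightarrow> (\<And>x. x \<in> D \<Longrightarrow> norm (f (t + (y + x))) \<le> B)
                 \<Longrightarrow> norm (f (t + y)) \<le> K * real (Suc n) ^ R * B"
    and "B \<ge> 0" "\<And>y. y \<in> step_sums D n \<Longrightarrow> norm (f (t + y)) \<le> B"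
  shows "norm (f t) \<le> K ^ n * fact n ^ R * B"
  using assms(4,5)
proof (induction n arbitrary: B)
  case 0
  show ?case using "0.prems"(2)[OF zero_in_step_sums] by simp
next
  case (Suc n)
  have "norm (f t) \<le> K ^ n * fact n ^ R * (K * real (Suc n) ^ R * B)"
  proof (rule Suc.IH)
    show "0 \<le> K * real (Suc n) ^ R * B" using assms(2) Suc.prems(1) by simp
    show "norm (f (t + y)) \<le> K * real (Suc n) ^ R * B" if "y \<in> step_sums D n" for y
      using that Suc.prems(1) by (rule step) (intro Suc.prems(2) step_sums_Suc assms(1) that)
  qed
  also have "\<dots> = K ^ Suc n * fact (Suc n) ^ R * B"
    by (simp add: power_mult_distrib del: of_nat_Suc)
  finally show ?case .
qed

text \<open>
  The moment bound with \<open>m = L n\<close> at distance \<open>n d / 2\<close> from the origin gives, up to factors exponential in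
  \<open>n\<close>, decay \<open>n powr (- (1 - s) L n)\<close>. For large fixed \<open>L\<close> this outweighs \<open>fact n ^ R \<le> n ^ (R n)\<close>;
  it is here that \<open>s < 1\<close> enters.
\<close>

lemma superexponential_decay_beats_iteration:
  fixes f :: "real \<Rightarrow> 'a::real_normed_vector"
  assumes decay: "\<And>m u. \<bar>u\<bar> ^ m * norm (f u) \<le> C * h ^ m * fact m powr s"
    and "C > 0" "h > 0" "0 < s" "s < 1" "d > 0" "K \<ge> 0"
    and iter: "\<And>n B. B \<ge> 0 \<Longrightarrow> (\<And>u. u \<ge> t + real n * d \<Longrightarrow> norm (f u) \<le> B)
                 \<Longrightarrow> norm (f t) \<le> K ^ n * fact n ^ R * B"
  shows "f t = 0"
proof -
  obtain L0 :: nat where L0: "(real R + 1) / (1 - s) \<le> real L0" using real_arch_simple by blast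
  define L where "L = Suc L0"
  have "(real R + 1) / (1 - s) \<le> real L" using L0 by (simp add: L_def)
  hence L: "real R + s * real L - real L \<le> -1" "L > 0" 
    using assms(5) by (auto simp: field_simps L_def)
  define K' where "K' = K * h ^ L * (real L powr (s * real L)) * (2 / d) ^ L"
  have K': "K' \<ge> 0" using assms by (simp add: K'_def)
  \<comment> \<open>The conditions on \<open>n\<close> make \<open>t + n d \<ge> n d / 2\<close>, and make the ratio of the geometric bound,
    which is at most \<open>K' / n\<close>, at most \<open>1 / 2\<close>.\<close>
  have bound: "norm (f t) \<le> C * (1 / 2) ^ n"
    if n: "n > 0" "2 * \<bar>t\<bar> / d \<le> real n" "2 * K' \<le> real n" for n
  proof -
    let ?m = "L * n"
    define q where "q = h ^ L * real ?m powr (s * real L) * (2 / (real n * d)) ^ L"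
    have q: "q \<ge> 0" using assms by (simp add: q_def)
    have "norm (f u) \<le> C * q ^ n" if u: "u \<ge> t + real n * d" for u
    proof -
      have nd: "0 < real n * d / 2" using n assms by simp
      have "2 * \<bar>t\<bar> \<le> real n * d" using n(2) assms(6) by (simp add: field_simps)
      hence un: "u \<ge> real n * d / 2" using u by (simp add: abs_if split: if_splits)
      have "(real n * d / 2) ^ ?m * norm (f u) \<le> \<bar>u\<bar> ^ ?m * norm (f u)"
        using un nd by (intro mult_right_mono power_mono) auto
      also have "\<dots> \<le> C * h ^ ?m * fact ?m powr s" by (rule decay)
      also have "\<dots> \<le> C * h ^ ?m * (real ?m ^ ?m) powr s"
        using assms fact_le_power[of ?m, where 'a = real] by (intro mult_left_mono powr_mono2) auto
      also have "(real ?m ^ ?m) powr s = (real ?m powr (s * real L)) ^ n"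
        using n L by (simp add: powr_realpow[symmetric] powr_powr mult_ac)
      finally have "norm (f u) \<le> C * h ^ ?m * (real ?m powr (s * real L)) ^ n / (real n * d / 2) ^ ?m"
        using nd by (subst pos_le_divide_eq) (simp_all only: zero_less_power mult.commute)
      also have "\<dots> = C * q ^ n"
        by (simp add: q_def power_mult_distrib power_divide power_mult)
      finally show ?thesis .
    qed
    hence "norm (f t) \<le> K ^ n * fact n ^ R * (C * q ^ n)"
      using assms(2) q by (intro iter) auto
    also have "\<dots> \<le> K ^ n * (real n ^ n) ^ R * (C * q ^ n)"
      using assms q fact_le_power[of n, where 'a = real] by (intro mult_right_mono mult_left_mono power_mono) auto
    also have "\<dots> = C * (K * real n ^ R * q) ^ n"
      by (simp add: power_mult_distrib power_mult[symmetric] mult.commute)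
    also have "K * real n ^ R * q = K' * real n powr (real R + s * real L - real L)"
      using n L assms by (simp add: q_def K'_def powr_add powr_diff powr_realpow powr_mult power_mult_distrib power_divide mult_ac)
    also have "C * (K' * real n powr (real R + s * real L - real L)) ^ n \<le> C * (1 / 2) ^ n"
    proof -
      have "K' * real n powr (real R + s * real L - real L) \<le> K' * real n powr (-1)"
        using n L K' by (intro mult_left_mono powr_mono) auto
      also have "\<dots> \<le> 1 / 2" using n by (simp add: powr_minus field_simps)
      finally show ?thesis using assms K' by (intro mult_left_mono power_mono) auto
    qed
    finally show ?thesis .
  qed
  have "norm (f t) \<le> 0"
  proof (rule tendsto_lowerbound)
    show "(\<lambda>n. C * (1 / 2) ^ n) \<longlonglongrightarrow> 0"
      by (intro tendsto_mult_right_zero LIMSEQ_power_zero) auto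
    have "\<forall>\<^sub>F n in sequentially. 2 * \<bar>t\<bar> / d \<le> real n" "\<forall>\<^sub>F n in sequentially. 2 * K' \<le> real n"
      using filterlim_real_sequentially unfolding filterlim_at_top by blast+
    thus "\<forall>\<^sub>F n in sequentially. norm (f t) \<le> C * (1 / 2) ^ n"
      using eventually_gt_at_top[of 0] by eventually_elim (rule bound)
  qed auto
  thus ?thesis by simp
qed

text \<open>
  Among the time shifts with a nonzero coefficient let \<open>x0\<close> be the largest. Solving the relation for the terms
  with this shift expresses \<open>f t\<close> through values of \<open>f\<close> strictly to the right of \<open>t\<close>, and the
  iteration applies. If \<open>x0\<close> is the only time shift then \<open>D = {}\<close> and the relation already says
  \<open>P t * f t = 0\<close>.
\<close>

lemma superexponential_decay_imp_no_weyl_relation: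
  fixes f :: "real \<Rightarrow> complex"
  assumes "finite J" "z \<in> J" "c z \<noteq> 0"
    and rel: "\<And>t. (\<Sum>z\<in>J. c z * weyl_shift z f t) = 0"
    and cont: "continuous_on UNIV f"
    and decay: "\<And>m u. \<bar>u\<bar> ^ m * norm (f u) \<le> C * h ^ m * fact m powr s"
    and "C > 0" "h > 0" "0 < s" "s < 1"
  shows "f t0 = 0"
proof (rule ccontr)
  assume "f t0 \<noteq> 0"
  moreover have "open {t. f t \<noteq> 0}" using cont by (intro open_Collect_neq continuous_intros)
  ultimately obtain e where e: "e > 0" "cball t0 e \<subseteq> {t. f t \<noteq> 0}"
    unfolding open_contains_cball by blast
  define J' where "J' = {z \<in> J. c z \<noteq> 0}"
  have J': "finite J'" "z \<in> J'" using assms by (auto simp: J'_def)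
  define x0 where "x0 = Max (fst ` J')"
  have x0: "fst y \<le> x0" if "y \<in> J'" for y using J' that by (simp add: x0_def)
  have "x0 \<in> fst ` J'" unfolding x0_def using J' by (intro Max_in) auto
  then obtain b where b: "b \<in> J'" "fst b = x0" by blast
  define A where "A = {z \<in> J'. fst z = x0}"
  define w where "w z = 2 * pi * snd z" for z :: "real \<times> real"
  define c' where "c' z = c z * cis (pi * snd z * x0)" for z
  let ?P = "exp_poly_deriv A c' w 0"
  have A: "finite A" "A \<subseteq> J'" "inj_on w A" "b \<in> A"
    using J' b by (auto simp: A_def inj_on_def w_def prod_eq_iff)
  have c'b: "c' b \<noteq> 0" using b by (simp add: c'_def J'_def)
  define D where "D = (\<lambda>z. x0 - fst z) ` (J' - A)"
  have D: "finite D" "\<And>x. x \<in> D \<Longrightarrow> x > 0"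
    using J' x0 by (auto simp: D_def A_def order_less_le)
  obtain d where d: "d > 0" "\<And>x. x \<in> D \<Longrightarrow> d \<le> x"
  proof (cases "D = {}")
    case False
    thus ?thesis using D that[of "Min D"] by simp
  qed (use that[of 1] in auto)
  define M where "M = (\<Sum>z\<in>J' - A. norm (c z))"
  have M: "M \<ge> 0" unfolding M_def by (intro sum_nonneg) auto
  \<comment> \<open>The relation at \<open>t + x0\<close>, solved for the terms in \<open>A\<close>, in absolute value.\<close>
  have recursion: "norm (?P t) * norm (f t) \<le> M * B"
    if "\<And>x. x \<in> D \<Longrightarrow> norm (f (t + x)) \<le> B" for t B
  proof -
    have "0 = (\<Sum>z\<in>J. c z * weyl_shift z f (t + x0))" by (simp add: rel)
    also have "\<dots> = (\<Sum>z\<in>J'. c z * weyl_shift z f (t + x0))"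
      unfolding J'_def using assms by (intro sum.mono_neutral_right) auto
    also have "\<dots> = (\<Sum>z\<in>A. c z * weyl_shift z f (t + x0)) + (\<Sum>z\<in>J' - A. c z * weyl_shift z f (t + x0))"
      using sum.subset_diff[OF A(2) J'(1)] by (simp add: add.commute)
    also have "(\<Sum>z\<in>A. c z * weyl_shift z f (t + x0)) = ?P t * f t"
      unfolding exp_poly_deriv_def sum_distrib_right
    proof (rule sum.cong)
      fix y assume "y \<in> A"
      hence [simp]: "fst y = x0" by (simp add: A_def)
      have "2 * pi * snd y * (t + x0 - x0 / 2) = pi * snd y * x0 + w y * t"
        by (simp add: w_def algebra_simps)
      thus "c y * weyl_shift y f (t + x0) = c' y * (\<i> * complex_of_real (w y)) ^ 0 * cis (w y * t) * f t"
        by (simp add: weyl_shift_eq_cis c'_def cis_mult)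
    qed simp
    finally have "norm (?P t * f t) = norm (\<Sum>z\<in>J' - A. c z * weyl_shift z f (t + x0))"
      by (metis add_eq_0_iff norm_minus_cancel)
    also have "\<dots> \<le> (\<Sum>z\<in>J' - A. norm (c z) * B)"
    proof (rule sum_norm_le)
      fix y assume "y \<in> J' - A"
      hence "x0 - fst y \<in> D" by (auto simp: D_def)
      from that[OF this] show "norm (c y * weyl_shift y f (t + x0)) \<le> norm (c y) * B"
        by (simp add: weyl_shift_eq_cis norm_mult mult_left_mono add_diff_eq)
    qed
    finally show ?thesis by (simp add: norm_mult M_def sum_distrib_right)
  qed
  have t0e: "t0 - e < t0 + e" using e by simp
  obtain a R t where a: "a > 0" and t: "t \<in> {t0 - e..t0 + e}"
    and low: "\<And>n y. y \<in> step_sums D n \<Longrightarrow> a / real (Suc n) ^ R \<le> norm (?P (t + y))"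
    by (rule exp_poly_lower_bound_along_step_sums[where c = c', OF A(1,3,4) c'b D(1) t0e]) (rule that)
  have "f t = 0"
  proof (rule superexponential_decay_beats_iteration[OF decay assms(7-10) d(1)])
    show "0 \<le> M / a" using M a by simp
    fix n B assume B: "0 \<le> (B::real)" "\<And>u. t + real n * d \<le> u \<Longrightarrow> norm (f u) \<le> B"
    show "norm (f t) \<le> (M / a) ^ n * fact n ^ R * B"
    proof (rule iterated_step_bound[OF D(1) \<open>0 \<le> M / a\<close> _ B(1)])
      show "norm (f (t + y)) \<le> B" if "y \<in> step_sums D n" for y
        using step_sums_ge[OF that d(2)] by (intro B(2)) auto
      fix k y and B :: real
      assume y: "y \<in> step_sums D k" and B: "\<And>x. x \<in> D \<Longrightarrow> norm (f (t + (y + x))) \<le> B"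
      have "a / real (Suc k) ^ R * norm (f (t + y)) \<le> norm (?P (t + y)) * norm (f (t + y))"
        by (intro mult_right_mono low y) auto
      also have "\<dots> \<le> M * B" using B by (intro recursion) (simp add: add.assoc)
      finally show "norm (f (t + y)) \<le> M / a * real (Suc k) ^ R * B"
        using a by (simp add: field_simps del: of_nat_Suc)
    qed
  qed
  moreover have "f t \<noteq> 0" using e t by (auto simp: dist_real_def subset_iff abs_if split: if_splits)
  ultimately show False by contradiction
qed

section \<open>The Fourier transform of rapidly decaying functions\<close>

lemma continuous_AE_zero_imp_zero:
  fixes f :: "real \<Rightarrow> 'a::real_normed_vector"
  assumes "continuous_on UNIV f" "AE t in lborel. f t = 0"
  shows "f t = 0"
proof (rule ccontr)
  assume "f t \<noteq> 0"
  have op: "open {t. f t \<noteq> 0}" using assms(1) by (intro open_Collect_neq continuous_intros)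
  then obtain e where e: "e > 0" "cball t e \<subseteq> {t. f t \<noteq> 0}"
    using \<open>f t \<noteq> 0\<close> unfolding open_contains_cball by blast
  have "{t. f t \<noteq> 0} \<in> null_sets lborel"
    using assms(2) op AE_iff_null[of lborel "\<lambda>t. f t = 0"] by (simp add: borel_open)
  hence "emeasure lborel (cball t e) \<le> 0"
    using emeasure_mono[OF e(2), of lborel] op by (auto simp: null_sets_def)
  moreover have "emeasure lborel (cball t e) = ennreal (2 * e)"
    using e by (simp add: cball_eq_atLeastAtMost)
  ultimately show False using e(1) by simp
qed

definition fourier :: "(real \<Rightarrow> complex) \<Rightarrow> real \<Rightarrow> complex" where
  "fourier f \<xi> = (LINT t|lborel. f t * cis (- (2 * pi * \<xi> * t)))"

lemma integrable_inverse_1_plus_square_lborel: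
  "integrable lborel (\<lambda>t::real. inverse (1 + t\<^sup>2))"
  using integrable_inverse_1_plus_square by (simp add: set_integrable_def)

lemma integral_inverse_1_plus_square_lborel:
  "(LINT t|lborel. inverse (1 + t\<^sup>2)) = pi"
  using LBINT_inverse_1_plus_square
  by (simp add: interval_lebesgue_integral_def set_lebesgue_integral_def)

lemma quadratic_decay_imp_le:
  fixes f :: "real \<Rightarrow> complex"
  assumes "(1 + t\<^sup>2) * norm (f t) \<le> B"
  shows "norm (f t) \<le> B * inverse (1 + t\<^sup>2)"
proof -
  have "1 + t\<^sup>2 > 0" by (simp add: add_pos_nonneg)
  thus ?thesis using assms by (simp add: field_simps)
qed

lemma integrable_quadratic_decay:
  fixes f :: "real \<Rightarrow> complex"
  assumes "continuous_on UNIV f" "\<And>t. (1 + t\<^sup>2) * norm (f t) \<le> B"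
  shows "integrable lborel f"
proof (rule Bochner_Integration.integrable_bound)
  show "integrable lborel (\<lambda>t::real. B * inverse (1 + t\<^sup>2))"
    by (intro integrable_mult_right integrable_inverse_1_plus_square_lborel)
  show "f \<in> borel_measurable lborel"
    using borel_measurable_continuous_onI[OF assms(1)] by simp
  show "AE t in lborel. norm (f t) \<le> norm (B * inverse (1 + t\<^sup>2))"
    using quadratic_decay_imp_le assms(2) by (intro AE_I2) (metis abs_ge_self order_trans real_norm_def)
qed

lemma integrable_mult_cis:
  assumes "integrable lborel f"
  shows "integrable lborel (\<lambda>t. f t * cis (a * t + b))"
proof (rule Bochner_Integration.integrable_bound[OF assms])
  have "(\<lambda>t. cis (a * t + b)) \<in> borel_measurable lborel"
    using borel_measurable_continuous_onI[of "\<lambda>t. cis (a * t + b)"] by (simp add: continuous_intros)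
  thus "(\<lambda>t. f t * cis (a * t + b)) \<in> borel_measurable lborel"
    using assms by (intro borel_measurable_times) auto
qed (simp add: norm_mult)

lemma integrable_fourier_integrand:
  assumes "integrable lborel f"
  shows "integrable lborel (\<lambda>t. f t * cis (- (2 * pi * \<xi> * t)))"
  using integrable_mult_cis[OF assms, of "- (2 * pi * \<xi>)" 0] by simp

lemma norm_fourier_le:
  assumes "continuous_on UNIV f" "\<And>t. (1 + t\<^sup>2) * norm (f t) \<le> B"
  shows "norm (fourier f \<xi>) \<le> B * pi"
proof -
  have int: "integrable lborel f" using assms by (rule integrable_quadratic_decay)
  have "norm (fourier f \<xi>) \<le> (LINT t|lborel. norm (f t))"
    using integral_norm_bound[of lborel "\<lambda>t. f t * cis (- (2 * pi * \<xi> * t))"]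
    by (simp add: fourier_def norm_mult)
  also have "\<dots> \<le> (LINT t|lborel. B * inverse (1 + t\<^sup>2))"
    using int assms(2)
    by (intro integral_mono integrable_norm integrable_mult_right integrable_inverse_1_plus_square_lborel
        quadratic_decay_imp_le) auto
  also have "\<dots> = B * pi"
    by (simp add: integral_inverse_1_plus_square_lborel)
  finally show ?thesis .
qed

lemma continuous_on_fourier:
  assumes "integrable lborel f"
  shows "continuous_on UNIV (fourier f)"
proof (rule continuous_at_imp_continuous_on, intro ballI)
  fix \<xi> :: real
  show "isCont (fourier f) \<xi>"
    unfolding continuous_at_sequentially
  proof (intro allI impI)
    fix X :: "nat \<Rightarrow> real" assume X: "X \<longlonglongrightarrow> \<xi>"
    show "(fourier f \<circ> X) \<longlonglongrightarrow> fourier f \<xi>"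
      unfolding fourier_def comp_def
    proof (rule integral_dominated_convergence[where w = "\<lambda>t. norm (f t)"])
      show "AE t in lborel. (\<lambda>n. f t * cis (- (2 * pi * X n * t))) \<longlonglongrightarrow> f t * cis (- (2 * pi * \<xi> * t))"
        using X by (intro AE_I2 tendsto_intros)
    qed (use assms integrable_fourier_integrand[OF assms] in \<open>auto simp: norm_mult intro: borel_measurable_integrable\<close>)
  qed
qed

lemma quadratic_decay_tendsto_0:
  fixes f :: "real \<Rightarrow> complex"
  assumes "\<And>t. (1 + t\<^sup>2) * norm (f t) \<le> B"
  shows "(f \<longlongrightarrow> 0) at_top" "(f \<longlongrightarrow> 0) at_bot"
proof -
  have lim: "((\<lambda>t. B * inverse (1 + t\<^sup>2)) \<longlongrightarrow> 0) F" if "filterlim (\<lambda>t. t\<^sup>2) at_top F" for F :: "real filter"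
    using that by (intro tendsto_mult_right_zero tendsto_inverse_0_at_top filterlim_tendsto_add_at_top[OF tendsto_const])
  have "filterlim (\<lambda>t::real. t\<^sup>2) at_top at_top"
    by (intro filterlim_pow_at_top filterlim_ident) auto
  moreover have "filterlim (\<lambda>t::real. t\<^sup>2) at_top at_bot"
    by (intro filterlim_pow_at_bot_even filterlim_ident) auto
  ultimately show "(f \<longlongrightarrow> 0) at_top" "(f \<longlongrightarrow> 0) at_bot"
    by (auto intro!: Lim_null_comparison[OF _ lim] always_eventually quadratic_decay_imp_le assms)
qed

text \<open>
  Integration by parts, as the statement that the derivative of \<open>g t * cis (- (2 * pi * \<xi> * t))\<close> has
  integral zero over the line.
\<close>

lemma fourier_derivative:
  assumes deriv: "\<And>t. (g has_vector_derivative g' t) (at t)" and cont: "continuous_on UNIV g'"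
    and g: "\<And>t. (1 + t\<^sup>2) * norm (g t) \<le> B" and g': "\<And>t. (1 + t\<^sup>2) * norm (g' t) \<le> B'"
  shows "fourier g' \<xi> = 2 * pi * \<i> * \<xi> * fourier g \<xi>"
proof -
  let ?e = "\<lambda>t. cis (- (2 * pi * \<xi> * t))"
  let ?k = "- (2 * pi * \<i> * \<xi>) :: complex"
  let ?\<Phi>' = "\<lambda>t. g t * (?k * ?e t) + g' t * ?e t"
  have contg: "continuous_on UNIV g"
    using deriv by (meson continuous_at_imp_continuous_on has_vector_derivative_continuous)
  have intg: "integrable lborel g" "integrable lborel g'"
    using integrable_quadratic_decay[OF contg g] integrable_quadratic_decay[OF cont g'] .
  note int = integrable_fourier_integrand[OF intg(1), of \<xi>] integrable_fourier_integrand[OF intg(2), of \<xi>]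
  have e': "(?e has_vector_derivative ?k * ?e t) (at t)" for t
    by (auto intro!: derivative_eq_intros simp: has_vector_derivative_def scaleR_conv_of_real algebra_simps)
  have int': "integrable lborel ?\<Phi>'"
    using integrable_mult_right[OF int(1), of ?k] int(2) by (intro Bochner_Integration.integrable_add) (simp_all add: mult_ac)
  have dec: "(1 + t\<^sup>2) * norm (g t * ?e t) \<le> B" for t using g by (simp add: norm_mult)
  have "(LBINT t=-\<infinity>..\<infinity>. ?\<Phi>' t) = 0 - 0"
  proof (rule interval_integral_FTC_integrable)
    show "((\<lambda>t. g t * ?e t) has_vector_derivative ?\<Phi>' x) (at x)" for x
      by (intro has_vector_derivative_mult deriv e')
    show "isCont ?\<Phi>' x" for x
    proof -
      have "continuous_on UNIV ?\<Phi>'" by (intro continuous_intros contg cont)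
      thus ?thesis by (simp add: continuous_on_eq_continuous_at)
    qed
    show "set_integrable lborel (einterval (-\<infinity>) \<infinity>) ?\<Phi>'"
      using int' by (simp add: set_integrable_def)
    show "(((\<lambda>t. g t * ?e t) \<circ> real_of_ereal) \<longlongrightarrow> 0) (at_right (-\<infinity>))"
      "(((\<lambda>t. g t * ?e t) \<circ> real_of_ereal) \<longlongrightarrow> 0) (at_left \<infinity>)"
      using quadratic_decay_tendsto_0[of "\<lambda>t. g t * ?e t", OF dec] by (simp_all add: ereal_tendsto_simps)
  qed simp
  hence "(LINT t|lborel. ?\<Phi>' t) = 0"
    by (simp add: interval_lebesgue_integral_def set_lebesgue_integral_def)
  also have "(LINT t|lborel. ?\<Phi>' t) = (LINT t|lborel. ?k * (g t * ?e t) + g' t * ?e t)"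
    by (intro Bochner_Integration.integral_cong) (simp_all add: mult_ac)
  also have "\<dots> = ?k * fourier g \<xi> + fourier g' \<xi>"
    unfolding fourier_def using int by (subst Bochner_Integration.integral_add) simp_all
  finally show ?thesis by (simp add: algebra_simps)
qed

text \<open>
  The symmetric phase \<open>t - x / 2\<close> in the Weyl shift makes the transform act by a rotation of the
  time-frequency plane by a right angle, without an additional scalar factor.
\<close>

lemma fourier_weyl_shift:
  "fourier (weyl_shift z f) \<xi> = weyl_shift (snd z, - fst z) (fourier f) \<xi>"
proof -
  let ?c = "cis (2 * pi * (- fst z) * (\<xi> - snd z / 2))"
  have "fourier (weyl_shift z f) \<xi>
      = (LINT t|lborel. weyl_shift z f (fst z + 1 * t) * cis (- (2 * pi * \<xi> * (fst z + 1 * t))))"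
    unfolding fourier_def by (subst lborel_integral_real_affine[where c = 1 and t = "fst z"]) simp_all
  also have "\<dots> = (LINT t|lborel. ?c * (f t * cis (- (2 * pi * (\<xi> - snd z) * t))))"
  proof (intro Bochner_Integration.integral_cong refl)
    fix t
    have "2 * pi * snd z * (fst z + t - fst z / 2) + - (2 * pi * \<xi> * (fst z + t))
        = 2 * pi * (- fst z) * (\<xi> - snd z / 2) + - (2 * pi * (\<xi> - snd z) * t)"
      by (simp add: field_simps)
    hence "cis (2 * pi * snd z * (fst z + t - fst z / 2)) * cis (- (2 * pi * \<xi> * (fst z + t)))
        = ?c * cis (- (2 * pi * (\<xi> - snd z) * t))"
      by (simp only: cis_mult)
    thus "weyl_shift z f (fst z + 1 * t) * cis (- (2 * pi * \<xi> * (fst z + 1 * t)))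
        = ?c * (f t * cis (- (2 * pi * (\<xi> - snd z) * t)))"
      by (simp add: weyl_shift_eq_cis mult_ac)
  qed
  also have "\<dots> = ?c * fourier f (\<xi> - snd z)"
    unfolding fourier_def by (rule integral_mult_right_zero)
  finally show ?thesis by (simp add: weyl_shift_eq_cis)
qed

lemma integrable_weyl_shift:
  assumes "integrable lborel f"
  shows "integrable lborel (weyl_shift z f)"
proof -
  have "integrable lborel (\<lambda>t. f (- fst z + 1 * t))"
    using assms by (intro lborel_integrable_real_affine) auto
  from integrable_mult_cis[OF this, of "2 * pi * snd z" "- (pi * snd z * fst z)"]
  show ?thesis
    by (simp add: weyl_shift_eq_cis[abs_def] algebra_simps)
qed

lemma fourier_sum_weyl_shift:
  assumes "finite J" "integrable lborel f"
  shows "fourier (\<lambda>t. \<Sum>z\<in>J. c z * weyl_shift z f t) \<xi>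
         = (\<Sum>z\<in>J. c z * weyl_shift (snd z, - fst z) (fourier f) \<xi>)"
proof -
  have "fourier (\<lambda>t. \<Sum>z\<in>J. c z * weyl_shift z f t) \<xi>
      = (LINT t|lborel. (\<Sum>z\<in>J. c z * (weyl_shift z f t * cis (- (2 * pi * \<xi> * t)))))"
    unfolding fourier_def by (simp add: sum_distrib_right mult.assoc)
  also have "\<dots> = (\<Sum>z\<in>J. LINT t|lborel. c z * (weyl_shift z f t * cis (- (2 * pi * \<xi> * t))))"
    using assms by (intro Bochner_Integration.integral_sum integrable_mult_right
        integrable_fourier_integrand integrable_weyl_shift)
  also have "\<dots> = (\<Sum>z\<in>J. c z * fourier (weyl_shift z f) \<xi>)"
    unfolding fourier_def by simp
  finally show ?thesis by (simp add: fourier_weyl_shift)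
qed

text \<open>
  Injectivity of the Fourier transform from Levy's uniqueness theorem: the positive and negative part of \<open>u\<close>
  have the same total mass (take \<open>\<theta> = 0\<close>) and, normalised to probability densities, the same
  characteristic function.
\<close>

lemma real_char_zero_imp_zero:
  fixes u :: "real \<Rightarrow> real"
  assumes cont: "continuous_on UNIV u" and int: "integrable lborel u"
    and zero: "\<And>\<theta>. (LINT t|lborel. u t * cis (\<theta> * t)) = 0"
  shows "u t = 0"
proof -
  define p where "p t = max (u t) 0" for t
  define q where "q t = max (- u t) 0" for t
  have p: "integrable lborel p" and q: "integrable lborel q"
    unfolding p_def q_def using int by (auto intro!: integrable_max)
  have pos: "0 \<le> p t" "0 \<le> q t" and upq: "u t = p t - q t" for t
    by (auto simp: p_def q_def)
  have int_cis: "integrable lborel (\<lambda>t. of_real (v t) * cis (\<theta> * t))" if "integrable lborel v" for v \<theta>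
    using integrable_mult_cis[of "\<lambda>t. of_real (v t)" \<theta> 0] that by simp
  have eq: "(LINT t|lborel. p t * cis (\<theta> * t)) = (LINT t|lborel. q t * cis (\<theta> * t))" for \<theta>
  proof -
    have "(LINT t|lborel. p t * cis (\<theta> * t)) - (LINT t|lborel. q t * cis (\<theta> * t))
        = (LINT t|lborel. p t * cis (\<theta> * t) - q t * cis (\<theta> * t))"
      by (rule Bochner_Integration.integral_diff[symmetric]) (intro int_cis p q)+
    also have "\<dots> = (LINT t|lborel. u t * cis (\<theta> * t))" by (simp add: upq algebra_simps)
    finally show ?thesis using zero by simp
  qed
  define m where "m = (LINT t|lborel. p t)"
  have "complex_of_real (LINT t|lborel. p t) = of_real (LINT t|lborel. q t)"
    using eq[of 0] by simp
  hence mq: "m = (LINT t|lborel. q t)" unfolding m_def by (simp only: of_real_eq_iff)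
  have "AE t in lborel. p t = q t"
  proof (cases "m = 0")
    case True
    have "AE t in lborel. p t = 0" "AE t in lborel. q t = 0"
      using integral_nonneg_eq_0_iff_AE[OF p] integral_nonneg_eq_0_iff_AE[OF q] True mq m_def pos by auto
    thus ?thesis by eventually_elim simp
  next
    case False
    moreover have "m \<ge> 0" unfolding m_def using pos by (intro integral_nonneg_AE AE_I2)
    ultimately have m: "m > 0" by simp
    define \<mu> where "\<mu> v = density lborel (\<lambda>t. ennreal (v t / m))" for v :: "real \<Rightarrow> real"
    have dist: "real_distribution (\<mu> v)" and char: "char (\<mu> v) \<theta> = (LINT t|lborel. v t * cis (\<theta> * t)) / m"
      if v: "integrable lborel v" "\<And>t. 0 \<le> v t" "(LINT t|lborel. v t) = m" for v \<theta>
    proof -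
      have meas: "(\<lambda>t. v t / m) \<in> borel_measurable lborel" using v(1) by auto
      have "emeasure (\<mu> v) (space (\<mu> v)) = (\<integral>\<^sup>+ t. ennreal (v t / m) \<partial>lborel)"
        unfolding \<mu>_def using meas by (subst emeasure_density) auto
      also have "\<dots> = ennreal (LINT t|lborel. v t / m)"
        using v m by (intro nn_integral_eq_integral) auto
      also have "\<dots> = 1" using v m by simp
      finally have "prob_space (\<mu> v)" by (rule prob_spaceI)
      thus "real_distribution (\<mu> v)"
        by (simp add: real_distribution_def real_distribution_axioms_def \<mu>_def)
      have "char (\<mu> v) \<theta> = (LINT t|lborel. (v t / m) *\<^sub>R iexp (\<theta> * t))"
        unfolding char_def \<mu>_def using meas v m by (intro integral_density) auto
      also have "\<dots> = (LINT t|lborel. (v t * cis (\<theta> * t)) / m)"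
        by (simp add: cis_conv_exp scaleR_conv_of_real)
      finally show "char (\<mu> v) \<theta> = (LINT t|lborel. v t * cis (\<theta> * t)) / m" by simp
    qed
    have "\<mu> p = \<mu> q"
      using p q pos m_def mq eq by (intro Levy_uniqueness dist ext) (simp_all add: char)
    hence "AE t in lborel. ennreal (p t / m) = ennreal (q t / m)"
      unfolding \<mu>_def using p q 
      by (subst (asm) sigma_finite_measure.density_unique_iff[OF sigma_finite_lborel]) auto
    thus ?thesis by eventually_elim (use pos m in \<open>simp add: ennreal_inj\<close>)
  qed
  hence "AE t in lborel. u t = 0" by eventually_elim (simp add: upq)
  thus ?thesis by (rule continuous_AE_zero_imp_zero[OF cont])
qed

text \<open>
  The transform of the conjugate vanishes as well, so the real and the imaginary part can be treated separately.
\<close>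

lemma fourier_zero_imp_zero:
  assumes cont: "continuous_on UNIV f" and int: "integrable lborel f" and zero: "\<And>\<xi>. fourier f \<xi> = 0"
  shows "f t = 0"
proof -
  have zero': "(LINT t|lborel. f t * cis (\<theta> * t)) = 0" for \<theta>
    using zero[of "- \<theta> / (2 * pi)"] by (simp add: fourier_def)
  have int': "integrable lborel (\<lambda>t. f t * cis (\<theta> * t))" for \<theta>
    using integrable_mult_cis[OF int, of \<theta> 0] by simp
  have cnj_zero: "(LINT t|lborel. cnj (f t) * cis (\<theta> * t)) = 0" for \<theta>
  proof -
    have "(LINT t|lborel. cnj (f t) * cis (\<theta> * t)) = (LINT t|lborel. cnj (f t * cis (- \<theta> * t)))"
      by (simp add: cis_cnj)
    also have "\<dots> = cnj (LINT t|lborel. f t * cis (- \<theta> * t))" 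
      by (rule Bochner_Integration.integral_cnj)
    finally show ?thesis using zero'[of "- \<theta>"] by simp
  qed
  have int_cnj: "integrable lborel (\<lambda>t. cnj (f t) * cis (\<theta> * t))" for \<theta>
    using integrable_mult_cis[of "\<lambda>t. cnj (f t)" \<theta> 0] int by simp
  have "Re (f t) = 0"
  proof (rule real_char_zero_imp_zero[where u = "\<lambda>t. Re (f t)"])
    show "continuous_on UNIV (\<lambda>t. Re (f t))" using cont by (intro continuous_intros)
    show "integrable lborel (\<lambda>t. Re (f t))" using int by auto
    fix \<theta>
    have "(LINT t|lborel. Re (f t) * cis (\<theta> * t))
        = (LINT t|lborel. (f t * cis (\<theta> * t) + cnj (f t) * cis (\<theta> * t)) / 2)"
      by (intro Bochner_Integration.integral_cong refl) (simp add: complex_eq_iff field_simps)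
    also have "\<dots> = 0" using int' int_cnj by (simp add: zero' cnj_zero)
    finally show "(LINT t|lborel. Re (f t) * cis (\<theta> * t)) = 0" .
  qed
  moreover have "Im (f t) = 0"
  proof (rule real_char_zero_imp_zero[where u = "\<lambda>t. Im (f t)"])
    show "continuous_on UNIV (\<lambda>t. Im (f t))" using cont by (intro continuous_intros)
    show "integrable lborel (\<lambda>t. Im (f t))" using int by auto
    fix \<theta>
    have "(LINT t|lborel. Im (f t) * cis (\<theta> * t))
        = (LINT t|lborel. - (\<i> / 2) * (f t * cis (\<theta> * t) - cnj (f t) * cis (\<theta> * t)))"
      by (intro Bochner_Integration.integral_cong refl) (simp add: complex_eq_iff field_simps)
    also have "\<dots> = 0" using int' int_cnj by (simp add: zero' cnj_zero)
    finally show "(LINT t|lborel. Im (f t) * cis (\<theta> * t)) = 0" .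
  qed
  ultimately show ?thesis by (simp add: complex_eq_iff)
qed

section \<open>Weyl shifts of Gelfand--Shilov functions\<close>

lemma smooth_has_vector_derivative:
  assumes "smooth f"
  shows "(nth_deriv n f has_vector_derivative nth_deriv (Suc n) f t) (at t)"
  using assms by (simp add: smooth_def nth_deriv_def vector_derivative_works)

lemma continuous_on_nth_deriv:
  assumes "smooth f"
  shows "continuous_on UNIV (nth_deriv n f)"
  using smooth_has_vector_derivative[OF assms]
  by (meson continuous_at_imp_continuous_on has_vector_derivative_continuous)

lemma fourier_nth_deriv:
  assumes "smooth f" "\<And>n t. (1 + t\<^sup>2) * norm (nth_deriv n f t) \<le> B n"
  shows "fourier (nth_deriv n f) \<xi> = (2 * pi * \<i> * \<xi>) ^ n * fourier f \<xi>"
proof (induction n)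
  case 0
  show ?case by (simp add: nth_deriv_def)
next
  case (Suc n)
  have "fourier (nth_deriv (Suc n) f) \<xi> = 2 * pi * \<i> * \<xi> * fourier (nth_deriv n f) \<xi>"
    by (rule fourier_derivative[OF smooth_has_vector_derivative continuous_on_nth_deriv assms(2) assms(2)])
       (rule assms)+
  thus ?case using Suc by simp
qed

text \<open>
  For \<open>s < 1\<close> the decay estimate applies to \<open>f\<close> itself. For \<open>\<sigma> < 1\<close> it applies to the Fourier transform,
  since \<open>(2 * pi * \<xi>) ^ n * fourier f \<xi>\<close> is up to a phase the transform of the \<open>n\<close>-th derivative, bounded
  by a multiple of \<open>h ^ n * fact n powr \<sigma>\<close>; the points of the relation are rotated accordingly.
\<close>

lemma gelfand_shilov_no_weyl_relation:
  assumes "f \<in> gelfand_shilov s \<sigma>" "0 < s" "0 < \<sigma>" "s < 1 \<or> \<sigma> < 1"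
    and "finite J" "z \<in> J" "c z \<noteq> 0" and rel: "\<And>t. (\<Sum>z\<in>J. c z * weyl_shift z f t) = 0"
  shows "f t = 0"
proof -
  obtain C h where Ch: "C > 0" "h > 0" and
    bound: "\<And>m n t. norm (of_real (t ^ m) * nth_deriv n f t) \<le> C * h ^ (m + n) * fact m powr s * fact n powr \<sigma>"
    using assms(1) unfolding gelfand_shilov_def by blast
  have smooth: "smooth f" using assms(1) by (simp add: gelfand_shilov_def)
  have bound': "\<bar>t\<bar> ^ m * norm (nth_deriv n f t) \<le> C * h ^ (m + n) * fact m powr s * fact n powr \<sigma>" for m n t
    using bound[of t m n] by (simp add: norm_mult norm_power)
  have f0: "nth_deriv 0 f = f" by (simp add: nth_deriv_def)
  have contf: "continuous_on UNIV f" using continuous_on_nth_deriv[OF smooth, of 0] by (simp add: f0)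
  show ?thesis
  proof (cases "s < 1")
    case True
    show ?thesis
    proof (rule superexponential_decay_imp_no_weyl_relation[where c = c and z = z and J = J])
      show "\<bar>u\<bar> ^ m * norm (f u) \<le> C * h ^ m * fact m powr s" for m u
        using bound'[of u m 0] by (simp add: f0)
    qed (use assms True Ch contf in auto)
  next
    case False
    hence \<sigma>: "\<sigma> < 1" using assms by simp
    define Q where "Q = C * (1 + h\<^sup>2 * 2 powr s)"
    have Q: "Q > 0" using Ch by (simp add: Q_def add_pos_nonneg)
    \<comment> \<open>The moments of order 0 and 2 suffice to make all derivatives integrable, uniformly.\<close>
    have decay: "(1 + t\<^sup>2) * norm (nth_deriv n f t) \<le> Q * h ^ n * fact n powr \<sigma>" for n t
      using bound'[of t 0 n] bound'[of t 2 n]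
      by (simp add: Q_def algebra_simps power_add power2_eq_square)
    have int: "integrable lborel f"
      using integrable_quadratic_decay[OF contf, of "Q * h ^ 0 * fact 0 powr \<sigma>"] decay[of _ 0] by (simp add: f0)
    let ?J = "(\<lambda>z. (snd z, - fst z)) ` J"
    have "fourier f \<xi> = 0" for \<xi>
    proof (rule superexponential_decay_imp_no_weyl_relation[where
          c = "\<lambda>z. c (- snd z, fst z)" and z = "(snd z, - fst z)" and J = ?J and s = \<sigma> and h = h and C = "Q * pi"])
      show "(\<Sum>z\<in>?J. c (- snd z, fst z) * weyl_shift z (fourier f) t) = 0" for t
      proof -
        have "(\<Sum>z\<in>?J. c (- snd z, fst z) * weyl_shift z (fourier f) t)
            = (\<Sum>z\<in>J. c z * weyl_shift (snd z, - fst z) (fourier f) t)"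
          by (subst sum.reindex) (auto simp: inj_on_def prod_eq_iff)
        also have "\<dots> = fourier (\<lambda>t. \<Sum>z\<in>J. c z * weyl_shift z f t) t"
          using fourier_sum_weyl_shift[OF assms(5) int] by simp
        also have "\<dots> = 0" by (simp add: rel fourier_def)
        finally show ?thesis .
      qed
      show "continuous_on UNIV (fourier f)" using int by (rule continuous_on_fourier)
      show "\<bar>u\<bar> ^ n * norm (fourier f u) \<le> Q * pi * h ^ n * fact n powr \<sigma>" for n u
      proof -
        have "1 * \<bar>u\<bar> \<le> 2 * pi * \<bar>u\<bar>" using pi_gt3 by (intro mult_right_mono) auto
        hence "\<bar>u\<bar> ^ n * norm (fourier f u) \<le> (2 * pi * \<bar>u\<bar>) ^ n * norm (fourier f u)"
          by (intro mult_right_mono power_mono) auto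
        also have "\<dots> = norm (fourier (nth_deriv n f) u)"
          using fourier_nth_deriv[OF smooth decay, of n u] by (simp add: norm_mult norm_power)
        also have "\<dots> \<le> Q * h ^ n * fact n powr \<sigma> * pi"
          by (rule norm_fourier_le[OF continuous_on_nth_deriv[OF smooth] decay])
        finally show ?thesis by (simp add: mult_ac)
      qed
    qed (use assms Q Ch \<sigma> in auto)
    thus ?thesis by (rule fourier_zero_imp_zero[OF contf int])
  qed
qed

theorem proposition5p2:
  fixes s \<sigma> :: real and f :: "real \<Rightarrow> complex" and \<Lambda> :: "(real \<times> real) set"
  assumes "s > 0" and "\<sigma> > 0"
    and "f \<in> gelfand_shilov s \<sigma>" and "f \<noteq> (\<lambda>t. 0)"
    and "s < 1 \<or> \<sigma> < 1"
    and "finite \<Lambda>"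
  shows "lin_indep_family_AE \<Lambda> (\<lambda>z. weyl_shift z f)"
  unfolding lin_indep_family_AE_def
proof (intro allI impI ballI)
  fix J c z
  assume J: "finite J" "J \<subseteq> \<Lambda>" "z \<in> J" and AE: "AE t in lborel. (\<Sum>z\<in>J. c z * weyl_shift z f t) = 0"
  have "smooth f" using assms(3) by (simp add: gelfand_shilov_def)
  hence contf: "continuous_on UNIV f"
    using continuous_on_nth_deriv[of f 0] by (simp add: nth_deriv_def)
  have "continuous_on UNIV (\<lambda>t. \<Sum>z\<in>J. c z * weyl_shift z f t)"
    unfolding weyl_shift_eq_cis
    by (intro continuous_intros continuous_on_compose2[OF contf]) auto
  hence "(\<Sum>z\<in>J. c z * weyl_shift z f t) = 0" for t
    using AE by (rule continuous_AE_zero_imp_zero)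
  hence "c z \<noteq> 0 \<Longrightarrow> f t = 0" for t
    using gelfand_shilov_no_weyl_relation[OF assms(3,1,2,5) J(1,3)] by blast
  thus "c z = 0" using assms(4) by blast
qed

end
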